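(* Let $X$ be a $(t,s)$-rack, i.e. a $\mathbb{Z}[t^{\pm 1},s]/(s^2-(1-t)s)$-module. Then $X$ is a Legendrian rack under the operations \[x\triangleright y = tx+sy \quad\text{and}\quad f(x)=ax+b\] for $a,b\in X$ if and only if \[a^2(t+s)=1 \quad\text{and}\quad (a+1)b=(1-a)s=(1-t)b=sb=0.\]
   Context: A rack is a set $X$ with two binary operations $\triangleright$ and $\overline{\triangleright}$ such that for all $x,y,z\in X$: (i) $(x\triangleright y)\,\overline{\triangleright}\, y = x = (x\,\overline{\triangleright}\, y)\triangleright y$; (ii) $(x\triangleright y)\triangleright z=(x\triangleright z)\triangleright(y\triangleright z)$. A $(t,s)$-rack is a module over $\mathbb{Z}[t^{\pm 1},s]/(s^2-(1-t)s)$ with the rack operation $x\triangleright y=tx+sy$ (the inverse operation being $x\,\overline{\triangleright}\,y=t^{-1}(x-sy)$). A Legendrian rack is a triple $(X,\triangleright,f)$ where $(X,\triangleright)$ is a rack and $f:X\to X$ is a map such that for all $x,y\in X$: (I) $f^2(x\triangleright x)=x=f^2(x)\triangleright x$; (II) $f(x\triangleright y)=f(x)\triangleright y$; (III) $x\triangleright f(y)=x\triangleright y$. Here $f^2=f\circ f$.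
   Formalization: For a bare module X the products ax, a², (a+1)b and the unit 1 in X are undefined; X is therefore taken to be a commutative unital algebra over Z[t^{±1},s]/(s²−(1−t)s), with t and s acting as scalars. *)

theory Defs
  imports
    "HOL-Library.Poly_Mapping"
    "HOL-Algebra.Module"
    "HOL-Algebra.QuotRing"
    "HOL-Algebra.Algebraic_Closure_Type"
begin

section \<open>Racks and Legendrian racks\<close>

locale rack =
  fixes Q :: "'a set"
    and rhd :: "'a \<Rightarrow> 'a \<Rightarrow> 'a"  (infixl \<open>\<triangleright>\<close> 70)
    and rhd_inv :: "'a \<Rightarrow> 'a \<Rightarrow> 'a"  (infixl \<open>\<triangleleft>\<close> 70)
  assumes rhd_closed: "\<lbrakk>x \<in> Q; y \<in> Q\<rbrakk> \<Longrightarrow> x \<triangleright> y \<in> Q"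
    and rhd_inv_closed: "\<lbrakk>x \<in> Q; y \<in> Q\<rbrakk> \<Longrightarrow> x \<triangleleft> y \<in> Q"
    and rhd_rhd_inv: "\<lbrakk>x \<in> Q; y \<in> Q\<rbrakk> \<Longrightarrow> (x \<triangleright> y) \<triangleleft> y = x"
    and rhd_inv_rhd: "\<lbrakk>x \<in> Q; y \<in> Q\<rbrakk> \<Longrightarrow> (x \<triangleleft> y) \<triangleright> y = x"
    and self_distrib:
      "\<lbrakk>x \<in> Q; y \<in> Q; z \<in> Q\<rbrakk> \<Longrightarrow> (x \<triangleright> y) \<triangleright> z = (x \<triangleright> z) \<triangleright> (y \<triangleright> z)"

locale legendrian_rack = rack +
  fixes f :: "'a \<Rightarrow> 'a"
  assumes f_closed: "x \<in> Q \<Longrightarrow> f x \<in> Q"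
    and f_f_rhd_self: "x \<in> Q \<Longrightarrow> f (f (x \<triangleright> x)) = x"
    and f_f_self_rhd: "x \<in> Q \<Longrightarrow> f (f x) \<triangleright> x = x"
    and f_rhd: "\<lbrakk>x \<in> Q; y \<in> Q\<rbrakk> \<Longrightarrow> f (x \<triangleright> y) = f x \<triangleright> y"
    and rhd_f: "\<lbrakk>x \<in> Q; y \<in> Q\<rbrakk> \<Longrightarrow> x \<triangleright> f y = x \<triangleright> y"


section \<open>The ring $\mathbb{Z}[t^{\pm 1},s]/(s^2-(1-t)s)$\<close>

text \<open>
  Finitely supported functions from the integers to the integers, multiplied by convolution,
  are the integral Laurent polynomials; the indeterminate is the function supported at 1
  with value 1.
\<close>

type_synonym int_laurent = "int \<Rightarrow>\<^sub>0 int"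

type_synonym ts_scalar = "int_laurent poly set"

definition t_poly :: "int_laurent poly" where
  "t_poly = [:Poly_Mapping.single 1 1:]"

definition s_poly :: "int_laurent poly" where
  "s_poly = [:0, 1:]"

abbreviation ts_poly_ring :: "int_laurent poly ring" where
  "ts_poly_ring \<equiv> ring_of_type_algebra"

definition ts_ideal :: "int_laurent poly set" where
  "ts_ideal = PIdl\<^bsub>ts_poly_ring\<^esub> (s_poly\<^sup>2 - (1 - t_poly) * s_poly)"

definition ts_ring :: "ts_scalar ring"  (\<open>\<Lambda>\<close>) where
  "\<Lambda> = ts_poly_ring Quot ts_ideal"

definition t_gen :: ts_scalar  (\<open>\<t>\<close>) where
  "\<t> = ts_ideal +>\<^bsub>ts_poly_ring\<^esub> t_poly"

definition s_gen :: ts_scalar  (\<open>\<s>\<close>) where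
  "\<s> = ts_ideal +>\<^bsub>ts_poly_ring\<^esub> s_poly"

lemma ideal_ts_ideal: "ideal ts_ideal ts_poly_ring"
proof -
  interpret P: cring ts_poly_ring by (rule cring_from_type_algebra)
  show ?thesis
    unfolding ts_ideal_def by (rule P.cgenideal_ideal) (simp add: ring_of_type_algebra_def)
qed

lemma cring_ts_ring: "cring \<Lambda>"
  unfolding ts_ring_def
  using ideal.quotient_is_cring[OF ideal_ts_ideal] cring_from_type_algebra by blast

lemma ts_coset_hom: "(+>\<^bsub>ts_poly_ring\<^esub>) ts_ideal \<in> ring_hom ts_poly_ring \<Lambda>"
  unfolding ts_ring_def by (rule ideal.rcos_ring_hom[OF ideal_ts_ideal])

lemma t_gen_closed: "\<t> \<in> carrier \<Lambda>"
  and s_gen_closed: "\<s> \<in> carrier \<Lambda>"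
  unfolding t_gen_def s_gen_def
  by (rule ring_hom_closed[OF ts_coset_hom]; simp add: ring_of_type_algebra_def)+

lemma t_gen_unit: "\<t> \<in> Units \<Lambda>"
proof -
  define u :: "int_laurent poly" where "u = [:Poly_Mapping.single (-1) 1:]"
  interpret L: cring \<Lambda> by (rule cring_ts_ring)
  have tu: "t_poly \<otimes>\<^bsub>ts_poly_ring\<^esub> u = \<one>\<^bsub>ts_poly_ring\<^esub>"
    by (simp add: ring_of_type_algebra_def t_poly_def u_def mult_single)
  have carr: "x \<in> carrier ts_poly_ring" for x
    by (simp add: ring_of_type_algebra_def)
  have u: "ts_ideal +>\<^bsub>ts_poly_ring\<^esub> u \<in> carrier \<Lambda>"
    by (rule ring_hom_closed[OF ts_coset_hom carr])
  have "\<t> \<otimes>\<^bsub>\<Lambda>\<^esub> (ts_ideal +>\<^bsub>ts_poly_ring\<^esub> u) = \<one>\<^bsub>\<Lambda>\<^esub>"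
    unfolding t_gen_def
    using ring_hom_mult[OF ts_coset_hom carr carr, of t_poly u] ring_hom_one[OF ts_coset_hom] tu
    by simp
  then show ?thesis
    using u t_gen_closed L.m_comm unfolding Units_def by (smt (verit) mem_Collect_eq)
qed

lemma s_gen_square: "\<s> [^]\<^bsub>\<Lambda>\<^esub> (2::nat) = (\<one>\<^bsub>\<Lambda>\<^esub> \<ominus>\<^bsub>\<Lambda>\<^esub> \<t>) \<otimes>\<^bsub>\<Lambda>\<^esub> \<s>"
proof -
  interpret P: cring ts_poly_ring by (rule cring_from_type_algebra)
  interpret L: cring \<Lambda> by (rule cring_ts_ring)
  interpret h: ring_hom_cring ts_poly_ring \<Lambda> "(+>\<^bsub>ts_poly_ring\<^esub>) ts_ideal"
    by (intro ring_hom_cring.intro ring_hom_cring_axioms.intro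
        P.cring_axioms L.cring_axioms ts_coset_hom)
  have carr: "x \<in> carrier ts_poly_ring" for x
    by (simp add: ring_of_type_algebra_def)
  have mult: "x \<otimes>\<^bsub>ts_poly_ring\<^esub> y = x * y" for x y
    by (simp add: ring_of_type_algebra_def)
  have add: "x \<oplus>\<^bsub>ts_poly_ring\<^esub> y = x + y" for x y
    by (simp add: ring_of_type_algebra_def)
  have minus: "x \<ominus>\<^bsub>ts_poly_ring\<^esub> y = x - y" for x y
  proof -
    have "\<ominus>\<^bsub>ts_poly_ring\<^esub> y = - y"
      by (rule P.minus_equality) (simp_all add: ring_of_type_algebra_def)
    then show ?thesis
      by (simp add: a_minus_def add)
  qed
  have one: "\<one>\<^bsub>ts_poly_ring\<^esub> = 1"
    by (simp add: ring_of_type_algebra_def)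
  let ?p = "s_poly * s_poly" and ?q = "(1 - t_poly) * s_poly"
  have "?p - ?q \<in> ts_ideal"
    using P.cgenideal_self[OF carr] by (simp add: ts_ideal_def power2_eq_square)
  then have "ts_ideal +>\<^bsub>ts_poly_ring\<^esub> ?p = ts_ideal +>\<^bsub>ts_poly_ring\<^esub> ?q"
    using P.quotient_eq_iff_same_a_r_cos[OF ideal_ts_ideal carr carr, of ?p ?q]
    by (simp add: minus)
  moreover have "ts_ideal +>\<^bsub>ts_poly_ring\<^esub> ?p = \<s> \<otimes>\<^bsub>\<Lambda>\<^esub> \<s>"
    using h.hom_mult[OF carr carr, of s_poly s_poly] by (simp add: s_gen_def mult)
  moreover have "ts_ideal +>\<^bsub>ts_poly_ring\<^esub> ?q = (\<one>\<^bsub>\<Lambda>\<^esub> \<ominus>\<^bsub>\<Lambda>\<^esub> \<t>) \<otimes>\<^bsub>\<Lambda>\<^esub> \<s>"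
  proof -
    have "ts_ideal +>\<^bsub>ts_poly_ring\<^esub> (1 - t_poly) = \<one>\<^bsub>\<Lambda>\<^esub> \<ominus>\<^bsub>\<Lambda>\<^esub> \<t>"
      using h.hom_add[OF carr carr, of "\<one>\<^bsub>ts_poly_ring\<^esub>" "\<ominus>\<^bsub>ts_poly_ring\<^esub> t_poly"]
        h.hom_a_inv[OF carr, of t_poly] h.hom_one minus[of "\<one>\<^bsub>ts_poly_ring\<^esub>" t_poly]
      by (simp add: t_gen_def a_minus_def one)
    then show ?thesis
      using h.hom_mult[OF carr carr, of "1 - t_poly" s_poly] by (simp add: s_gen_def mult)
  qed
  ultimately show ?thesis
    by (simp add: L.nat_pow_Suc numeral_2_eq_2 s_gen_closed)
qed


section \<open>The operations of a $(t,s)$-rack\<close>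

text \<open>
  A $(t,s)$-rack needs only the module part of the record \<open>M\<close>. For a map
  $x \mapsto ax+b$ with both coefficients $a$ and $b$ in $M$, the record is to be used with
  \<^locale>\<open>algebra\<close>, whose ring multiplication and unit give a meaning to $ax$ and $1$,
  while $t$, $s$ and polynomials in them always act as scalars.
\<close>

definition ts_rhd :: "(ts_scalar, 'a, 'm) module_scheme \<Rightarrow> 'a \<Rightarrow> 'a \<Rightarrow> 'a" where
  "ts_rhd M x y = (\<t> \<odot>\<^bsub>M\<^esub> x) \<oplus>\<^bsub>M\<^esub> (\<s> \<odot>\<^bsub>M\<^esub> y)"

definition ts_rhd_inv :: "(ts_scalar, 'a, 'm) module_scheme \<Rightarrow> 'a \<Rightarrow> 'a \<Rightarrow> 'a" where
  "ts_rhd_inv M x y = inv\<^bsub>\<Lambda>\<^esub> \<t> \<odot>\<^bsub>M\<^esub> (x \<ominus>\<^bsub>M\<^esub> (\<s> \<odot>\<^bsub>M\<^esub> y))"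

end

theory Submission
  imports Defs
begin

text \<open>
  Every module over \<open>\<Lambda>\<close> is a rack under \<open>ts_rhd\<close>: the inverse operation undoes it because \<open>t\<close>
  is a unit, and comparing the two sides of self-distributivity leaves only
  $sz = (ts + s^2)z$, which is the relation $s^2 = (1-t)s$. So for a map $f(x) = ax+b$ only the
  Legendrian axioms are at stake (\<open>legendrian_rack_affine_iff\<close>). Since
  $f^2(x) = a^2x + (a+1)b$, each of them equates two affine maps over the commutative ring \<open>M\<close>,
  and such an identity amounts to equality of coefficients: it holds everywhere as soon as it
  holds when all arguments are 0 and when one of them is 1 and any other is 0
  (\<open>affine_legendrian_axioms_iff\<close>). At 0 the axioms give $(a+1)b = 0$, $b = tb$ and $sb = 0$; at 1
  they give $a^2(t+s) = 1$, $ta^2 + s = 1$ and $as = s$. The condition $ta^2 + s = 1$ is absent from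
  the statement because $as = s$ implies $a^2(t+s) = ta^2 + s$.
\<close>

lemma ts_scalar_relation: "\<t> \<otimes>\<^bsub>\<Lambda>\<^esub> \<s> \<oplus>\<^bsub>\<Lambda>\<^esub> \<s> \<otimes>\<^bsub>\<Lambda>\<^esub> \<s> = \<s>"
proof -
  interpret L: cring \<Lambda> by (rule cring_ts_ring)
  note [simp] = t_gen_closed s_gen_closed
  have "\<s> \<otimes>\<^bsub>\<Lambda>\<^esub> \<s> = (\<one>\<^bsub>\<Lambda>\<^esub> \<ominus>\<^bsub>\<Lambda>\<^esub> \<t>) \<otimes>\<^bsub>\<Lambda>\<^esub> \<s>"
    using s_gen_square by (simp add: numeral_2_eq_2)
  also have "\<dots> = \<s> \<ominus>\<^bsub>\<Lambda>\<^esub> \<t> \<otimes>\<^bsub>\<Lambda>\<^esub> \<s>"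
    by (simp add: L.minus_eq L.l_distr L.l_minus)
  finally show ?thesis
    by (simp add: L.minus_eq L.a_lcomm L.r_neg)
qed

lemma ts_rack:
  fixes M :: "(ts_scalar, 'a, 'm) module_scheme"
  assumes "module \<Lambda> M"
  shows "rack (carrier M) (ts_rhd M) (ts_rhd_inv M)"
proof -
  interpret module \<Lambda> M by (rule assms)
  note [simp] = t_gen_closed s_gen_closed R.Units_inv_closed[OF t_gen_unit]
    R.Units_l_inv[OF t_gen_unit] R.Units_r_inv[OF t_gen_unit]
  note cancel = smult_assoc1[symmetric] M.minus_eq M.a_assoc M.r_neg M.l_neg
  show ?thesis
  proof
    fix x y z assume [simp]: "x \<in> carrier M" "y \<in> carrier M"
    show "ts_rhd M x y \<in> carrier M" "ts_rhd_inv M x y \<in> carrier M"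
      by (simp_all add: ts_rhd_def ts_rhd_inv_def)
    show "ts_rhd_inv M (ts_rhd M x y) y = x" "ts_rhd M (ts_rhd_inv M x y) y = x"
      by (simp_all add: ts_rhd_def ts_rhd_inv_def cancel)
    assume [simp]: "z \<in> carrier M"
    have "\<s> \<odot>\<^bsub>M\<^esub> z = (\<t> \<otimes>\<^bsub>\<Lambda>\<^esub> \<s> \<oplus>\<^bsub>\<Lambda>\<^esub> \<s> \<otimes>\<^bsub>\<Lambda>\<^esub> \<s>) \<odot>\<^bsub>M\<^esub> z"
      by (simp only: ts_scalar_relation)
    then have sz: "\<t> \<odot>\<^bsub>M\<^esub> (\<s> \<odot>\<^bsub>M\<^esub> z) \<oplus>\<^bsub>M\<^esub> \<s> \<odot>\<^bsub>M\<^esub> (\<s> \<odot>\<^bsub>M\<^esub> z) = \<s> \<odot>\<^bsub>M\<^esub> z"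
      by (simp add: smult_l_distr smult_assoc1)
    have "\<t> \<odot>\<^bsub>M\<^esub> (\<s> \<odot>\<^bsub>M\<^esub> y) = \<s> \<odot>\<^bsub>M\<^esub> (\<t> \<odot>\<^bsub>M\<^esub> y)"
      by (simp add: smult_assoc1[symmetric] R.m_comm)
    then have "ts_rhd M (ts_rhd M x z) (ts_rhd M y z) =
        \<t> \<odot>\<^bsub>M\<^esub> (ts_rhd M x y) \<oplus>\<^bsub>M\<^esub> (\<t> \<odot>\<^bsub>M\<^esub> (\<s> \<odot>\<^bsub>M\<^esub> z) \<oplus>\<^bsub>M\<^esub> \<s> \<odot>\<^bsub>M\<^esub> (\<s> \<odot>\<^bsub>M\<^esub> z))"
      by (simp add: ts_rhd_def smult_r_distr M.a_ac)
    then show "ts_rhd M (ts_rhd M x y) z = ts_rhd M (ts_rhd M x z) (ts_rhd M y z)"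
      by (simp add: sz) (simp add: ts_rhd_def)
  qed
qed

text \<open>
  Rewriting scalars as ring elements puts every condition into the commutative ring \<open>M\<close>, where
  sums of products have a normal form.
\<close>

lemma (in algebra) smult_eq_mult:
  assumes "r \<in> carrier R" "x \<in> carrier M"
  shows "r \<odot>\<^bsub>M\<^esub> x = (r \<odot>\<^bsub>M\<^esub> \<one>\<^bsub>M\<^esub>) \<otimes>\<^bsub>M\<^esub> x"
  using assms by (simp add: smult_assoc2)

text \<open>
  The axioms compare affine maps, so the equivalence is a comparison of coefficients, valid for
  arbitrary ring elements \<open>t\<close> and \<open>s\<close>. Each condition is read off at an argument 0 or 1; conversely
  the conditions match the coefficients. The right side uses equations without subtraction, so
  that they rewrite terms.
\<close>

lemma (in cring) affine_legendrian_axioms_iff: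
  fixes t s a b
  assumes [simp]: "t \<in> carrier R" "s \<in> carrier R" "a \<in> carrier R" "b \<in> carrier R"
  defines "f \<equiv> \<lambda>x. a \<otimes> x \<oplus> b"
    and "rhd \<equiv> \<lambda>x y. t \<otimes> x \<oplus> s \<otimes> y"
  shows "(\<forall>x\<in>carrier R. f (f (rhd x x)) = x \<and> rhd (f (f x)) x = x) \<and>
      (\<forall>x\<in>carrier R. \<forall>y\<in>carrier R. f (rhd x y) = rhd (f x) y \<and> rhd x (f y) = rhd x y) \<longleftrightarrow>
    a \<otimes> a \<otimes> (t \<oplus> s) = \<one> \<and> (a \<oplus> \<one>) \<otimes> b = \<zero> \<and> s \<otimes> a = s \<and> t \<otimes> b = b \<and> s \<otimes> b = \<zero>"
    (is "?axioms \<longleftrightarrow> ?conditions")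
proof
  have ff: "f (f x) = a \<otimes> a \<otimes> x \<oplus> (a \<oplus> \<one>) \<otimes> b" if "x \<in> carrier R" for x
    using that by (simp add: f_def l_distr r_distr m_assoc a_assoc)
  {
    assume ?axioms
    then have I: "f (f (rhd x x)) = x" if "x \<in> carrier R" for x
      using that by blast
    from \<open>?axioms\<close> have II: "f (rhd x y) = rhd (f x) y" and III: "rhd x (f y) = rhd x y"
      if "x \<in> carrier R" "y \<in> carrier R" for x y
      using that by blast+
    have ab: "(a \<oplus> \<one>) \<otimes> b = \<zero>"
      using I[of \<zero>] by (simp add: ff rhd_def)
    moreover have "a \<otimes> a \<otimes> (t \<oplus> s) = \<one>"
      using I[of \<one>] ab by (simp add: ff rhd_def)
    moreover have tb: "t \<otimes> b = b"
      using II[of \<zero> \<zero>] by (simp add: f_def rhd_def)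
    moreover have "s \<otimes> a = s"
      using II[of \<zero> \<one>] tb by (simp add: f_def rhd_def m_comm a_comm)
    moreover have "s \<otimes> b = \<zero>"
      using III[of \<zero> \<zero>] by (simp add: f_def rhd_def)
    ultimately show ?conditions by blast
  }
  {
    assume ?conditions
    then have aats: "a \<otimes> a \<otimes> (t \<oplus> s) = \<one>" and ab: "(a \<oplus> \<one>) \<otimes> b = \<zero>"
      and sa: "s \<otimes> a = s" and tb: "t \<otimes> b = b" and sb: "s \<otimes> b = \<zero>"
      by auto
    have "s \<otimes> (a \<otimes> a) = s"
      using sa by (simp flip: m_assoc)
    \<comment> \<open>the coefficient of \<open>x\<close> in the second half of (I), which has no condition of its own\<close>
    then have taas: "t \<otimes> (a \<otimes> a) \<oplus> s = \<one>"
      using aats by (simp add: r_distr m_comm[of "a \<otimes> a"])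
    have sax: "s \<otimes> (a \<otimes> x) = s \<otimes> x" if "x \<in> carrier R" for x
      using that sa by (simp flip: m_assoc)
    have "f (f (rhd x x)) = x" "rhd (f (f x)) x = x" if [simp]: "x \<in> carrier R" for x
    proof -
      have "f (f (rhd x x)) = a \<otimes> a \<otimes> (t \<oplus> s) \<otimes> x"
        by (simp add: ff rhd_def ab l_distr m_assoc)
      then show "f (f (rhd x x)) = x" by (simp add: aats)
      have "rhd (f (f x)) x = (t \<otimes> (a \<otimes> a) \<oplus> s) \<otimes> x"
        by (simp add: ff rhd_def ab l_distr m_assoc)
      then show "rhd (f (f x)) x = x" by (simp add: taas)
    qed
    moreover have "f (rhd x y) = rhd (f x) y" "rhd x (f y) = rhd x y"
      if [simp]: "x \<in> carrier R" "y \<in> carrier R" for x y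
      by (simp_all add: f_def rhd_def r_distr m_lcomm[of a] sax tb sb a_ac)
    ultimately show ?axioms by blast
  }
qed

text \<open>
  The rack axioms and the closure of \<open>f\<close> hold unconditionally, so a Legendrian structure amounts
  to the four equations (I), (II), (III).
\<close>

lemma legendrian_rack_affine_iff:
  fixes M :: "(ts_scalar, 'a, 'm) module_scheme"
  assumes "algebra \<Lambda> M" and [simp]: "a \<in> carrier M" "b \<in> carrier M"
  defines "f \<equiv> \<lambda>x. (a \<otimes>\<^bsub>M\<^esub> x) \<oplus>\<^bsub>M\<^esub> b"
  shows "legendrian_rack (carrier M) (ts_rhd M) (ts_rhd_inv M) f \<longleftrightarrow>
    (\<forall>x\<in>carrier M. f (f (ts_rhd M x x)) = x \<and> ts_rhd M (f (f x)) x = x) \<and>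
    (\<forall>x\<in>carrier M. \<forall>y\<in>carrier M.
      f (ts_rhd M x y) = ts_rhd M (f x) y \<and> ts_rhd M x (f y) = ts_rhd M x y)"
proof -
  interpret algebra \<Lambda> M by (rule assms)
  have "\<forall>x. x \<in> carrier M \<longrightarrow> f x \<in> carrier M"
    by (simp add: f_def)
  then show ?thesis
    by (simp add: legendrian_rack_def legendrian_rack_axioms_def ts_rack[OF module_axioms]
        Ball_def) meson
qed

theorem proposition3:
  fixes M :: "(ts_scalar, 'a, 'm) module_scheme"
    and a b :: 'a
  assumes "algebra \<Lambda> M"
    and "a \<in> carrier M"
    and "b \<in> carrier M"
  shows "legendrian_rack (carrier M) (ts_rhd M) (ts_rhd_inv M) (\<lambda>x. (a \<otimes>\<^bsub>M\<^esub> x) \<oplus>\<^bsub>M\<^esub> b) \<longleftrightarrow>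
    (\<t> \<oplus>\<^bsub>\<Lambda>\<^esub> \<s>) \<odot>\<^bsub>M\<^esub> (a [^]\<^bsub>M\<^esub> (2::nat)) = \<one>\<^bsub>M\<^esub> \<and>
    (a \<oplus>\<^bsub>M\<^esub> \<one>\<^bsub>M\<^esub>) \<otimes>\<^bsub>M\<^esub> b = \<zero>\<^bsub>M\<^esub> \<and>
    \<s> \<odot>\<^bsub>M\<^esub> (\<one>\<^bsub>M\<^esub> \<ominus>\<^bsub>M\<^esub> a) = \<zero>\<^bsub>M\<^esub> \<and>
    (\<one>\<^bsub>\<Lambda>\<^esub> \<ominus>\<^bsub>\<Lambda>\<^esub> \<t>) \<odot>\<^bsub>M\<^esub> b = \<zero>\<^bsub>M\<^esub> \<and>
    \<s> \<odot>\<^bsub>M\<^esub> b = \<zero>\<^bsub>M\<^esub>"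
proof -
  interpret algebra \<Lambda> M by (rule assms(1))
  note [simp] = t_gen_closed s_gen_closed assms(2,3)
  define T where "T = \<t> \<odot>\<^bsub>M\<^esub> \<one>\<^bsub>M\<^esub>"
  define S where "S = \<s> \<odot>\<^bsub>M\<^esub> \<one>\<^bsub>M\<^esub>"
  have [simp]: "T \<in> carrier M" "S \<in> carrier M"
    by (simp_all add: T_def S_def)
  have T: "\<t> \<odot>\<^bsub>M\<^esub> x = T \<otimes>\<^bsub>M\<^esub> x" and S: "\<s> \<odot>\<^bsub>M\<^esub> x = S \<otimes>\<^bsub>M\<^esub> x" if "x \<in> carrier M" for x
    using that smult_eq_mult[of _ x] by (simp_all add: T_def S_def)
  have "legendrian_rack (carrier M) (ts_rhd M) (ts_rhd_inv M) (\<lambda>x. (a \<otimes>\<^bsub>M\<^esub> x) \<oplus>\<^bsub>M\<^esub> b) \<longleftrightarrow>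
    a \<otimes>\<^bsub>M\<^esub> a \<otimes>\<^bsub>M\<^esub> (T \<oplus>\<^bsub>M\<^esub> S) = \<one>\<^bsub>M\<^esub> \<and> (a \<oplus>\<^bsub>M\<^esub> \<one>\<^bsub>M\<^esub>) \<otimes>\<^bsub>M\<^esub> b = \<zero>\<^bsub>M\<^esub> \<and>
    S \<otimes>\<^bsub>M\<^esub> a = S \<and> T \<otimes>\<^bsub>M\<^esub> b = b \<and> S \<otimes>\<^bsub>M\<^esub> b = \<zero>\<^bsub>M\<^esub>"
    unfolding legendrian_rack_affine_iff[OF assms]
    by (subst cring.affine_legendrian_axioms_iff[OF M_cring, symmetric]) (simp_all add: ts_rhd_def T S)
  moreover have "(\<t> \<oplus>\<^bsub>\<Lambda>\<^esub> \<s>) \<odot>\<^bsub>M\<^esub> (a [^]\<^bsub>M\<^esub> (2::nat)) = a \<otimes>\<^bsub>M\<^esub> a \<otimes>\<^bsub>M\<^esub> (T \<oplus>\<^bsub>M\<^esub> S)"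
    by (simp add: numeral_2_eq_2 smult_l_distr T S r_distr m_comm)
  moreover have "\<s> \<odot>\<^bsub>M\<^esub> (\<one>\<^bsub>M\<^esub> \<ominus>\<^bsub>M\<^esub> a) = S \<ominus>\<^bsub>M\<^esub> S \<otimes>\<^bsub>M\<^esub> a"
    by (simp add: S M.minus_eq r_distr r_minus)
  moreover have "(\<one>\<^bsub>\<Lambda>\<^esub> \<ominus>\<^bsub>\<Lambda>\<^esub> \<t>) \<odot>\<^bsub>M\<^esub> b = b \<ominus>\<^bsub>M\<^esub> T \<otimes>\<^bsub>M\<^esub> b"
    by (simp add: R.minus_eq M.minus_eq smult_l_distr smult_l_minus T)
  ultimately show ?thesis
    by (auto simp: S)
qed

end
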